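(* For every real $\alpha>1$ and every $\epsilon>0$, for all sufficiently large $m$ we have $$H_2(m,\alpha)>\tfrac12(\lambda(\alpha)-\epsilon)\,m\,\alpha^m.$$ Consequently, for every integer $r\geq 3$ and every $\epsilon>0$, for all sufficiently large $m$, $$\operatorname{forb}(m,r,M)\geq\left(1+\frac{r-1}{2(r-2)^2}\lambda\!\left(\frac{r-1}{r-2}\right)-\epsilon\right)m(r-1)^{m-1}+(r-1)^m.$$
   Context: For $\alpha>1$, $\lambda(\alpha)=\sum_{j=1}^\infty\frac{2^{j-1}}{\alpha^{2^j}}$. An $r$-matrix is a matrix with entries in $\{0,1,\dots,r-1\}$; it is simple if its columns are pairwise distinct. A matrix $A$ contains a configuration of $F$ if some submatrix of $A$ is a row and column permutation of $F$. Let $M=\begin{bmatrix}0&1\\0&1\\1&0\end{bmatrix}$, and $\operatorname{forb}(m,r,M)$ is the maximum number of columns of an $m$-rowed simple $r$-matrix containing no configuration of $M$. A triangular choice multigraph (TCM) $\mathcal{G}$ on a vertex set $V$ is obtained by choosing, for every 3-element subset $\{u,v,w\}\subseteq V$, exactly one of the pairs $uv,uw,vw$ and adding one copy of it as an edge; $m^{\mathcal{G}}_{xy}$ is the multiplicity of the pair $xy$, and for a TCM on $[m]$, $w(\mathcal{G},\alpha)=\sum_{xy\in\binom{[m]}{2}}\alpha^{m^{\mathcal{G}}_{xy}}$. A TCM $\mathcal{G}$ on $V$ is 2-recursive if either $|V|\in\{1,2\}$ and $\mathcal{G}$ is empty, or $|V|\geq 3$ and there is a partition $V=V_1\cup V_2$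 with $V_1,V_2\neq\emptyset$ such that $\mathcal{G}=\mathcal{G}_1\cup\mathcal{G}_2\cup\mathcal{G}_3$ (union with multiplicities), where $\mathcal{G}_i$ is a 2-recursive TCM on $V_i$ and $\mathcal{G}_3$ consists of: for every triple with $u,v\in V_1$, $w\in V_2$ a copy of $uv$, and for every triple with $u\in V_1$, $v,w\in V_2$ a copy of $vw$. $H_2(m,\alpha)$ is the maximum of $w(\mathcal{G},\alpha)$ over all 2-recursive TCMs on $[m]$. *)

theory Defs
  imports
    Complex_Main
    "HOL-Library.Multiset"
    "HOL-Combinatorics.Permutations"
    "Jordan_Normal_Form.Matrix"
    "Jordan_Normal_Form.DL_Submatrix"
begin

text \<open>The sum over j = 1, 2, ... is reindexed to start at 0.\<close>

definition lambda_series :: "real \<Rightarrow> real" where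
  "lambda_series \<alpha> = (\<Sum>j. 2 ^ j / \<alpha> ^ (2 ^ Suc j))"


section \<open>Matrices and configurations\<close>

definition r_matrix :: "nat \<Rightarrow> nat mat \<Rightarrow> bool" where
  "r_matrix r A \<longleftrightarrow> elements_mat A \<subseteq> {0..<r}"

definition simple_matrix :: "'a mat \<Rightarrow> bool" where
  "simple_matrix A \<longleftrightarrow> distinct (cols A)"

text \<open>
  \<^term>\<open>submatrix A I J\<close> ignores the indices in I and J that lie outside A; equality of matrices
  includes equality of the dimensions, so the selected submatrix has exactly the shape of F.
\<close>

definition contains_configuration :: "'a mat \<Rightarrow> 'a mat \<Rightarrow> bool" where
  "contains_configuration A F \<longleftrightarrow>
     (\<exists>I J p q. p permutes {0..<dim_row F} \<and> q permutes {0..<dim_col F} \<and>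
        submatrix A I J = mat (dim_row F) (dim_col F) (\<lambda>(i, j). F $$ (p i, q j)))"

text \<open>
  The column counts range over a set that is finite (at most r ^ m columns are possible) and,
  when F is not an empty matrix, contains 0 (the matrix without columns).
\<close>

definition forb :: "nat \<Rightarrow> nat \<Rightarrow> nat mat \<Rightarrow> nat" where
  "forb m r F = Max {dim_col A | A. dim_row A = m \<and> r_matrix r A \<and> simple_matrix A \<and>
                        \<not> contains_configuration A F}"

definition M_matrix :: "nat mat" where
  "M_matrix = mat_of_rows_list 2 [[0, 1],
                                  [0, 1],
                                  [1, 0]]"


section \<open>Triangular choice multigraphs\<close>

text \<open>
  A multigraph is the multiset of its edges, an edge being a 2-element set of vertices; the
  multiplicity of the pair xy is the count of {x, y}.
\<close>

definition triples :: "'a set \<Rightarrow> 'a set set" where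
  "triples V = {T. T \<subseteq> V \<and> card T = 3}"

definition tcm :: "'a set \<Rightarrow> 'a set multiset \<Rightarrow> bool" where
  "tcm V G \<longleftrightarrow> finite V \<and>
     (\<exists>c. (\<forall>T \<in> triples V. c T \<subseteq> T \<and> card (c T) = 2) \<and>
          G = image_mset c (mset_set (triples V)))"

definition weight :: "nat \<Rightarrow> nat set multiset \<Rightarrow> real \<Rightarrow> real" where
  "weight m G \<alpha> = (\<Sum>e \<in> {e. e \<subseteq> {1..m} \<and> card e = 2}. \<alpha> ^ count G e)"

text \<open>
  For a triple T meeting both parts, the chosen edge consists of the two vertices of T that lie
  in the same part.
\<close>

definition crossing_edges :: "'a set \<Rightarrow> 'a set \<Rightarrow> 'a set multiset" where
  "crossing_edges V1 V2 =
     image_mset (\<lambda>T. T \<inter> V1)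
       (mset_set {T \<in> triples (V1 \<union> V2). card (T \<inter> V1) = 2 \<and> card (T \<inter> V2) = 1}) +
     image_mset (\<lambda>T. T \<inter> V2)
       (mset_set {T \<in> triples (V1 \<union> V2). card (T \<inter> V1) = 1 \<and> card (T \<inter> V2) = 2})"

inductive two_recursive :: "'a set \<Rightarrow> 'a set multiset \<Rightarrow> bool" where
  base: "tcm V {#} \<Longrightarrow> card V \<in> {1, 2} \<Longrightarrow> two_recursive V {#}"
| step: "tcm V G \<Longrightarrow> card V \<ge> 3 \<Longrightarrow>
         V = V1 \<union> V2 \<Longrightarrow> V1 \<inter> V2 = {} \<Longrightarrow> V1 \<noteq> {} \<Longrightarrow> V2 \<noteq> {} \<Longrightarrow>
         two_recursive V1 G1 \<Longrightarrow> two_recursive V2 G2 \<Longrightarrow>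
         G = G1 + G2 + crossing_edges V1 V2 \<Longrightarrow> two_recursive V G"

text \<open>
  For m at least 1 this is the maximum of a finite nonempty set (a finite vertex set carries only
  finitely many TCMs); the value at m = 0 is irrelevant.
\<close>

definition H2 :: "nat \<Rightarrow> real \<Rightarrow> real" where
  "H2 m \<alpha> = Max {weight m G \<alpha> | G. two_recursive {1..m} G}"

end

theory Submission
  imports Defs
begin

text \<open>
  A binary tree describes how an m-element set is split recursively into two parts. In the
  corresponding 2-recursive TCM, a pair separated at a node W gets one copy for every vertex outside
  W, hence contributes \<alpha> to the power m - |W|, and the total weight is \<alpha>^m times the sum of
  |W1| |W2| / \<alpha>^|W| over the internal nodes W = W1 + W2. Complete binary trees with 2^k leaves,
  strung together to reach m leaves, bring this sum close to \<lambda>(\<alpha>) m / 2.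

  For the matrices, call a column sorted if no 0 stands above a 1. There are
  m (r-1)^(m-1) + (r-1)^m sorted columns. If the parts of the tree are intervals of rows, every pair
  u < v separated at a node W allows further columns, whose only 0 above a 1 is the 0 in row u with
  the 1 in row v: outside W no 0 occurs before W and no 1 after W, and the rest of W has neither.
  With \<alpha> = (r-1)/(r-2), their number is (r-2)^(m-2) times the weight above, and no
  configuration of M arises.
\<close>

section \<open>Splitting trees and their weight\<close>

datatype split_tree = Tip | Split split_tree split_tree

primrec leaves :: "split_tree \<Rightarrow> nat" where
  "leaves Tip = 1"
| "leaves (Split l r) = leaves l + leaves r"

text \<open>The weight of the multigraph built from a tree, divided by
  \<open>\<alpha> ^ leaves t\<close>. This normalisation absorbs the factor
  \<open>\<alpha> ^ (leaves r)\<close> that the pairs in the left part acquire at a split, and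
  symmetrically on the right, so that the recursion is additive.\<close>

primrec split_sum :: "real \<Rightarrow> split_tree \<Rightarrow> real" where
  "split_sum \<alpha> Tip = 0"
| "split_sum \<alpha> (Split l r) =
     split_sum \<alpha> l + split_sum \<alpha> r + real (leaves l) * real (leaves r) / \<alpha> ^ (leaves l + leaves r)"

lemma leaves_pos: "0 < leaves t"
  by (induction t) auto

primrec full_tree :: "nat \<Rightarrow> split_tree" where
  "full_tree 0 = Tip"
| "full_tree (Suc k) = Split (full_tree k) (full_tree k)"

lemma leaves_full_tree: "leaves (full_tree k) = 2 ^ k"
  by (induction k) auto

text \<open>For each \<open>j < k\<close> there are \<open>2 ^ (k - 1 - j)\<close> nodes with two
  children of \<open>2 ^ j\<close> leaves each, and each such node contributes
  \<open>4 ^ j / \<alpha> ^ (2 ^ Suc j)\<close>. The result is half the number of leaves times a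
  partial sum of \<open>lambda_series\<close>.\<close>

lemma split_sum_full_tree:
  "split_sum \<alpha> (full_tree k) = 2 ^ k / 2 * (\<Sum>j<k. 2 ^ j / \<alpha> ^ (2 ^ Suc j))"
proof (induction k)
  case (Suc k)
  have "split_sum \<alpha> (full_tree (Suc k)) =
      2 * split_sum \<alpha> (full_tree k) + 2 ^ k * 2 ^ k / \<alpha> ^ (2 ^ Suc k)"
    by (simp only: full_tree.simps split_sum.simps leaves_full_tree power_Suc mult_2 of_nat_power of_nat_numeral)
  then show ?case by (simp add: Suc.IH distrib_left)
qed simp

text \<open>Copies of \<open>b\<close> are joined one by one to a remainder tree with
  \<open>s\<close> leaves. Joining nodes and remainder contribute nonnegative amounts, so only the
  blocks are counted.\<close>

lemma exists_tree_ge_blocks: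
  assumes "0 < \<alpha>" "0 < s"
  shows "\<exists>t. leaves t = q * leaves b + s \<and> split_sum \<alpha> t \<ge> real q * split_sum \<alpha> b"
proof (induction q)
  case 0
  from assms(2) have "\<exists>t. leaves t = s \<and> split_sum \<alpha> t \<ge> 0"
  proof (induction s rule: nat_induct_non_zero)
    case 1
    show ?case by (rule exI[of _ Tip]) auto
  next
    case (Suc s)
    then obtain t where "leaves t = s" "split_sum \<alpha> t \<ge> 0" by blast
    with assms(1) show ?case by (intro exI[of _ "Split Tip t"]) auto
  qed
  then show ?case by simp
next
  case (Suc q)
  then obtain t where t: "leaves t = q * leaves b + s" "split_sum \<alpha> t \<ge> real q * split_sum \<alpha> b"
    by blast
  have "0 \<le> real (leaves b) * real (leaves t) / \<alpha> ^ (leaves b + leaves t)"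
    using assms(1) by simp
  then have "split_sum \<alpha> (Split b t) \<ge> split_sum \<alpha> b + split_sum \<alpha> t" by simp
  then have "split_sum \<alpha> (Split b t) \<ge> real (Suc q) * split_sum \<alpha> b"
    using t(2) by (simp add: distrib_right del: split_sum.simps)
  moreover have "leaves (Split b t) = Suc q * leaves b + s" using t(1) by simp
  ultimately show ?case by blast
qed

section \<open>Convergence of the lambda series and trees approaching its value\<close>

lemma summable_lambda_series:
  fixes \<alpha> :: real
  assumes "\<alpha> > 1"
  shows "summable (\<lambda>j. 2 ^ j / \<alpha> ^ (2 ^ Suc j))"
proof -
  \<comment> \<open>The terms in question are half the terms of this series at the indices
    \<open>2 ^ Suc j\<close>, so a subseries suffices.\<close>
  have "summable (\<lambda>n. real n * (1 / \<alpha>) ^ n)"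
  proof -
    \<comment> \<open>The formal derivative of the geometric series has coefficients
      \<open>n + 1\<close>; subtracting the geometric series leaves \<open>n\<close>.\<close>
    have "summable (\<lambda>n. diffs (\<lambda>_. 1) n * (1 / \<alpha>) ^ n)"
      by (rule termdiff_converges[where K = 1]) (use assms in \<open>simp_all add: summable_geometric\<close>)
    moreover have "summable (\<lambda>n. (1 / \<alpha>) ^ n)"
      using assms by (intro summable_geometric) auto
    ultimately have "summable (\<lambda>n. diffs (\<lambda>_. 1) n * (1 / \<alpha>) ^ n - (1 / \<alpha>) ^ n)"
      by (rule summable_diff)
    then show ?thesis by (simp add: diffs_def algebra_simps)
  qed
  moreover have "inj (\<lambda>j. 2 ^ Suc j :: nat)"
    by (auto intro!: injI)
  ultimately have "summable ((\<lambda>n. real n * (1 / \<alpha>) ^ n) \<circ> (\<lambda>j. 2 ^ Suc j))"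
    by (rule summable_reindex) (use assms in simp)
  from summable_mult[OF this, of "1 / 2"] show ?thesis
    by (simp add: o_def power_divide)
qed

text \<open>A fixed block size \<open>2 ^ k\<close> already brings the partial sum above
  \<open>lambda_series \<alpha> - \<epsilon>\<close>. The at most \<open>2 ^ k\<close> leaves
  outside the blocks cost a bounded amount, while the slack grows linearly in
  \<open>m\<close>.\<close>

lemma eventually_exists_tree:
  assumes "\<alpha> > 1" "\<epsilon> > 0"
  shows "\<forall>\<^sub>F m in sequentially.
           \<exists>t. leaves t = m \<and> split_sum \<alpha> t > 1 / 2 * (lambda_series \<alpha> - \<epsilon>) * real m"
proof -
  define L where "L k = (\<Sum>j<k. 2 ^ j / \<alpha> ^ (2 ^ Suc j))" for k :: nat
  have "L \<longlonglongrightarrow> lambda_series \<alpha>"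
    unfolding L_def lambda_series_def using summable_LIMSEQ[OF summable_lambda_series[OF assms(1)]] .
  then have "\<forall>\<^sub>F k in sequentially. L k > lambda_series \<alpha> - \<epsilon>"
    using assms(2) by (intro order_tendstoD) auto
  then obtain k where k: "L k > lambda_series \<alpha> - \<epsilon>"
    by (auto simp: eventually_sequentially)
  define d where "d = L k - (lambda_series \<alpha> - \<epsilon>)"
  have "d > 0" using k by (simp add: d_def)
  have L: "L k \<ge> 0" using assms(1) by (auto simp: L_def intro!: sum_nonneg)
  have "filterlim real at_top sequentially" by (rule filterlim_real_sequentially)
  \<comment> \<open>Beyond this threshold the slack \<open>d * m\<close> exceeds
    \<open>2 ^ k * L k\<close>, the most that the remainder can cost (up to the common factor
    1/2).\<close>
  then have "\<forall>\<^sub>F m in sequentially. real m > 2 ^ k * L k / d"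
    by (simp add: filterlim_at_top_dense)
  moreover have "\<forall>\<^sub>F m in sequentially. m > (0::nat)"
    by (rule eventually_gt_at_top)
  ultimately show ?thesis
  proof eventually_elim
    case (elim m)
    \<comment> \<open>Dividing \<open>m - 1\<close> instead of \<open>m\<close> puts
      \<open>s\<close> between 1 and \<open>2 ^ k\<close>: the remainder must be a tree, hence have
      a leaf.\<close>
    define q where "q = (m - 1) div 2 ^ k"
    define s where "s = Suc ((m - 1) mod 2 ^ k)"
    have m: "m = q * 2 ^ k + s"
      using elim(2) div_mult_mod_eq[of "m - 1" "2 ^ k"] by (simp add: q_def s_def)
    have "0 < s" by (simp add: s_def)
    have "s \<le> 2 ^ k" by (simp add: s_def Suc_leI)
    then have "real s \<le> 2 ^ k" by (metis of_nat_le_iff of_nat_numeral of_nat_power)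
    obtain t where t: "leaves t = m" "split_sum \<alpha> t \<ge> real q * split_sum \<alpha> (full_tree k)"
      using exists_tree_ge_blocks[of \<alpha> s q "full_tree k"] assms(1) \<open>0 < s\<close>
      by (auto simp: leaves_full_tree m[symmetric])
    have "(real m - 2 ^ k) * L k \<le> (real q * 2 ^ k) * L k"
      using L \<open>real s \<le> 2 ^ k\<close> by (intro mult_right_mono) (auto simp: m)
    moreover have "(lambda_series \<alpha> - \<epsilon>) * real m < (real m - 2 ^ k) * L k"
      using elim(1) \<open>d > 0\<close> by (simp add: d_def field_simps)
    ultimately show ?case
      using t by (intro exI[of _ t]) (auto simp: split_sum_full_tree L_def)
  qed
qed

section \<open>2-recursive triangular choice multigraphs\<close>

text \<open>The function \<open>weight\<close> on an arbitrary vertex set, since an induction over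
  splits leaves the initial intervals.\<close>

definition pair_weight :: "'a set \<Rightarrow> 'a set multiset \<Rightarrow> real \<Rightarrow> real" where
  "pair_weight V G \<alpha> = (\<Sum>e | e \<subseteq> V \<and> card e = 2. \<alpha> ^ count G e)"

lemma count_image_mset_mset_set:
  assumes "finite A"
  shows "count (image_mset f (mset_set A)) e = card {x \<in> A. f x = e}"
  using assms by (simp add: count_image_mset vimage_def Int_def conj_commute)

lemma two_recursive_tcm: "two_recursive V G \<Longrightarrow> tcm V G"
  by (induction rule: two_recursive.induct)

lemma finite_triples: "finite V \<Longrightarrow> finite (triples V)"
  by (simp add: triples_def)

lemma triples_eq_empty:
  assumes "finite V" "card V < 3"
  shows "triples V = {}"
proof -
  have "card T \<noteq> 3" if "T \<subseteq> V" for T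
    using card_mono[OF assms(1) that] assms(2) by simp
  then show ?thesis by (auto simp: triples_def)
qed

lemma set_mset_tcm:
  assumes "tcm V G" "e \<in># G"
  shows "e \<subseteq> V \<and> card e = 2"
proof -
  from assms obtain c T where "T \<in> triples V" "e = c T" "c T \<subseteq> T" "card (c T) = 2"
    by (auto simp: tcm_def finite_triples)
  then show ?thesis by (auto simp: triples_def)
qed

text \<open>A TCM has one edge per triple, so it is the multiset of a list of fixed length over
  \<open>Pow V\<close>. This makes the maximum in \<open>H2\<close> one over a finite set.\<close>

lemma finite_tcms:
  assumes "finite V"
  shows "finite {G. tcm V G}"
proof -
  have "{G. tcm V G} \<subseteq> mset ` {xs. set xs \<subseteq> Pow V \<and> length xs = card (triples V)}"
  proof
    fix G assume "G \<in> {G. tcm V G}"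
    then have G: "tcm V G" by simp
    obtain xs where xs: "mset xs = G" using ex_mset by blast
    have "set xs \<subseteq> Pow V" using set_mset_tcm[OF G] by (auto simp: xs[symmetric])
    moreover have "size G = card (triples V)" using G by (auto simp: tcm_def)
    then have "length xs = card (triples V)" by (simp add: xs[symmetric])
    ultimately show "G \<in> mset ` {xs. set xs \<subseteq> Pow V \<and> length xs = card (triples V)}"
      using xs by blast
  qed
  moreover have "finite {xs. set xs \<subseteq> Pow V \<and> length xs = card (triples V)}"
    using assms by (intro finite_lists_length_eq) simp
  ultimately show ?thesis by (rule finite_surj[rotated])
qed

section \<open>Gluing two triangular choice multigraphs along a partition\<close>

lemma crossing_edges_commute: "crossing_edges V1 V2 = crossing_edges V2 V1"
  by (simp add: crossing_edges_def add.commute Un_commute conj_commute)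

text \<open>A triple lies inside \<open>V1\<close>, inside \<open>V2\<close>, or is split two to
  one. The given choices serve the first two kinds, and the two vertices on the same side are chosen
  for the third.\<close>

lemma tcm_crossing:
  assumes "tcm V1 G1" "tcm V2 G2" "V1 \<inter> V2 = {}"
  shows "tcm (V1 \<union> V2) (G1 + G2 + crossing_edges V1 V2)"
proof -
  from assms(1) obtain c1 where c1: "finite V1" "\<And>T. T \<in> triples V1 \<Longrightarrow> c1 T \<subseteq> T \<and> card (c1 T) = 2"
    "G1 = image_mset c1 (mset_set (triples V1))"
    by (auto simp: tcm_def)
  from assms(2) obtain c2 where c2: "finite V2" "\<And>T. T \<in> triples V2 \<Longrightarrow> c2 T \<subseteq> T \<and> card (c2 T) = 2"
    "G2 = image_mset c2 (mset_set (triples V2))"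
    by (auto simp: tcm_def)
  define A where "A = {T \<in> triples (V1 \<union> V2). card (T \<inter> V1) = 2 \<and> card (T \<inter> V2) = 1}"
  define B where "B = {T \<in> triples (V1 \<union> V2). card (T \<inter> V1) = 1 \<and> card (T \<inter> V2) = 2}"
  define c where "c T = (if T \<subseteq> V1 then c1 T else if T \<subseteq> V2 then c2 T
                         else if card (T \<inter> V1) = 2 then T \<inter> V1 else T \<inter> V2)" for T
  have fin: "finite (triples V1)" "finite (triples V2)" "finite A" "finite B"
    using c1(1) c2(1) by (auto simp: A_def B_def finite_triples)
  have parts: "T \<inter> V1 = {} \<longleftrightarrow> T \<subseteq> V2" "T \<inter> V2 = {} \<longleftrightarrow> T \<subseteq> V1"
      "card (T \<inter> V1) + card (T \<inter> V2) = 3" "card (T \<inter> V1) = 0 \<longleftrightarrow> T \<inter> V1 = {}"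
      "card (T \<inter> V2) = 0 \<longleftrightarrow> T \<inter> V2 = {}"
    if "T \<in> triples (V1 \<union> V2)" for T
  proof -
    have T: "T \<subseteq> V1 \<union> V2" "card T = 3" using that by (auto simp: triples_def)
    show "T \<inter> V1 = {} \<longleftrightarrow> T \<subseteq> V2" "T \<inter> V2 = {} \<longleftrightarrow> T \<subseteq> V1"
      using T(1) assms(3) by auto
    have "T = (T \<inter> V1) \<union> (T \<inter> V2)" using T(1) by auto
    then have "card T = card (T \<inter> V1) + card (T \<inter> V2)"
      using c1(1) c2(1) assms(3) card_Un_disjoint[of "T \<inter> V1" "T \<inter> V2"] by auto
    then show "card (T \<inter> V1) + card (T \<inter> V2) = 3" using T(2) by simp
    show "card (T \<inter> V1) = 0 \<longleftrightarrow> T \<inter> V1 = {}" "card (T \<inter> V2) = 0 \<longleftrightarrow> T \<inter> V2 = {}"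
      using c1(1) c2(1) by auto
  qed
  have sub: "triples V1 \<subseteq> triples (V1 \<union> V2)" "triples V2 \<subseteq> triples (V1 \<union> V2)"
    by (auto simp: triples_def)
  have decomp: "triples (V1 \<union> V2) = triples V1 \<union> triples V2 \<union> (A \<union> B)" (is "?L = ?R")
  proof
    show "?R \<subseteq> ?L" using sub by (auto simp: A_def B_def)
    show "?L \<subseteq> ?R"
    proof
      fix T assume T: "T \<in> ?L"
      then have "card (T \<inter> V1) = 0 \<or> card (T \<inter> V2) = 0 \<or>
          card (T \<inter> V1) = 2 \<and> card (T \<inter> V2) = 1 \<or> card (T \<inter> V1) = 1 \<and> card (T \<inter> V2) = 2"
        using parts(3)[OF T] by presburger
      then show "T \<in> ?R"
        using T parts[OF T] by (auto simp: A_def B_def triples_def)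
    qed
  qed
  have in_A: "\<not> T \<subseteq> V1" "\<not> T \<subseteq> V2" "card (T \<inter> V1) = 2" if "T \<in> A" for T
    using that parts[of T] by (auto simp: A_def)
  have in_B: "\<not> T \<subseteq> V1" "\<not> T \<subseteq> V2" "card (T \<inter> V1) = 1" "card (T \<inter> V2) = 2" if "T \<in> B" for T
    using that parts[of T] by (auto simp: B_def)
  have in_2: "\<not> T \<subseteq> V1" "T \<subseteq> V2" if "T \<in> triples V2" for T
  proof -
    show T: "T \<subseteq> V2" using that by (simp add: triples_def)
    show "\<not> T \<subseteq> V1"
    proof
      assume "T \<subseteq> V1"
      with T assms(3) have "T = {}" by blast
      with that show False by (simp add: triples_def)
    qed
  qed
  have in_1: "T \<subseteq> V1" if "T \<in> triples V1" for T
    using that by (auto simp: triples_def)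
  have disj: "triples V1 \<inter> triples V2 = {}" "A \<inter> B = {}" "(triples V1 \<union> triples V2) \<inter> (A \<union> B) = {}"
  proof -
    show "triples V1 \<inter> triples V2 = {}" using in_1 in_2(1) by blast
    show "A \<inter> B = {}" by (auto simp: A_def B_def)
    show "(triples V1 \<union> triples V2) \<inter> (A \<union> B) = {}"
      unfolding disjoint_iff by (metis Un_iff in_1 in_2(2) in_A(1,2) in_B(1,2))
  qed
  \<comment> \<open>The four classes of triples are disjoint, so the edge multiset can be evaluated
    class by class, where \<open>c\<close> has a simple form.\<close>
  have "mset_set (triples (V1 \<union> V2)) =
          mset_set (triples V1) + mset_set (triples V2) + (mset_set A + mset_set B)"
    unfolding decomp using fin disj by (simp add: mset_set_Union)
  then have "image_mset c (mset_set (triples (V1 \<union> V2))) =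
      image_mset c (mset_set (triples V1)) + image_mset c (mset_set (triples V2)) +
      (image_mset c (mset_set A) + image_mset c (mset_set B))"
    by simp
  also have "image_mset c (mset_set (triples V1)) = G1"
    unfolding c1(3) using fin in_1 by (intro image_mset_cong) (auto simp: c_def)
  also have "image_mset c (mset_set (triples V2)) = G2"
    unfolding c2(3) using fin in_2 by (intro image_mset_cong) (auto simp: c_def)
  also have "image_mset c (mset_set A) = image_mset (\<lambda>T. T \<inter> V1) (mset_set A)"
    using fin in_A by (intro image_mset_cong) (auto simp: c_def)
  also have "image_mset c (mset_set B) = image_mset (\<lambda>T. T \<inter> V2) (mset_set B)"
    using fin in_B by (intro image_mset_cong) (auto simp: c_def)
  also have "image_mset (\<lambda>T. T \<inter> V1) (mset_set A) + image_mset (\<lambda>T. T \<inter> V2) (mset_set B) =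
      crossing_edges V1 V2"
    by (simp add: crossing_edges_def A_def B_def)
  finally have "G1 + G2 + crossing_edges V1 V2 = image_mset c (mset_set (triples (V1 \<union> V2)))" ..
  moreover have "c T \<subseteq> T \<and> card (c T) = 2" if "T \<in> triples (V1 \<union> V2)" for T
    using that c1(2)[of T] c2(2)[of T] in_1[of T] in_2[of T] in_A[of T] in_B[of T]
    unfolding decomp by (auto simp: c_def)
  ultimately show ?thesis
    unfolding tcm_def using c1(1) c2(1) by blast
qed

text \<open>The split triples whose trace on \<open>V1\<close> is \<open>e\<close> are obtained from
  \<open>e\<close> by adding one vertex of \<open>V2\<close>. Traces on \<open>V2\<close> never
  equal \<open>e\<close>.\<close>

lemma count_crossing_edges_inside:
  assumes "finite V1" "finite V2" "V1 \<inter> V2 = {}" "e \<subseteq> V1" "card e = 2"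
  shows "count (crossing_edges V1 V2) e = card V2"
proof -
  define A where "A = {T \<in> triples (V1 \<union> V2). card (T \<inter> V1) = 2 \<and> card (T \<inter> V2) = 1}"
  define B where "B = {T \<in> triples (V1 \<union> V2). card (T \<inter> V1) = 1 \<and> card (T \<inter> V2) = 2}"
  have "finite e" using assms(1,4) finite_subset by blast
  have fin: "finite A" "finite B" using assms by (auto simp: A_def B_def finite_triples)
  have A: "{T \<in> A. T \<inter> V1 = e} = (\<lambda>v. insert v e) ` V2" (is "?L = ?R")
  proof
    show "?L \<subseteq> ?R"
    proof
      fix T assume T: "T \<in> ?L"
      then obtain v where "T \<inter> V2 = {v}" by (auto simp: A_def card_1_singleton_iff)
      with T have "T = insert v e" "v \<in> V2" by (auto simp: A_def triples_def)
      then show "T \<in> ?R" by blast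
    qed
    show "?R \<subseteq> ?L"
    proof
      fix T assume "T \<in> ?R"
      then obtain v where v: "v \<in> V2" "T = insert v e" by blast
      have disj: "v \<notin> V1" "e \<inter> V2 = {}" using v(1) assms(3,4) by blast+
      have T: "T \<inter> V1 = e" "T \<inter> V2 = {v}"
        using v disj assms(4) by (simp_all add: Int_insert_left Int_absorb2)
      have "v \<notin> e" using disj v(1) by blast
      then have "card T = 3" using v(2) assms(5) \<open>finite e\<close> by simp
      moreover have "T \<subseteq> V1 \<union> V2" using v assms(4) by blast
      ultimately show "T \<in> ?L" using T assms(5) by (simp add: A_def triples_def)
    qed
  qed
  have "\<not> e \<subseteq> V2"
  proof
    assume "e \<subseteq> V2"
    with assms(3,4) have "e = {}" by blast
    with assms(5) show False by simp
  qed
  then have B: "{T \<in> B. T \<inter> V2 = e} = {}" by blast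
  have "inj_on (\<lambda>v. insert v e) V2"
  proof (rule inj_onI)
    fix v w assume vw: "v \<in> V2" "w \<in> V2" "insert v e = insert w e"
    have "v \<notin> e" using vw(1) assms(3,4) by blast
    then show "v = w" using vw(3) by blast
  qed
  then show ?thesis
    unfolding crossing_edges_def A_def[symmetric] B_def[symmetric]
    by (simp add: count_image_mset_mset_set fin A B card_image)
qed

lemma count_crossing_edges_across:
  assumes "finite V1" "finite V2" "\<not> e \<subseteq> V1" "\<not> e \<subseteq> V2"
  shows "count (crossing_edges V1 V2) e = 0"
  using assms by (auto simp: crossing_edges_def count_eq_zero_iff)

text \<open>A pair inside one part gains one copy for every vertex of the other part, which
  multiplies its weight by a power of \<open>\<alpha>\<close>. A separated pair has multiplicity 0
  and weighs 1.\<close>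

lemma pair_weight_crossing:
  assumes "tcm V1 G1" "tcm V2 G2" "V1 \<inter> V2 = {}"
  shows "pair_weight (V1 \<union> V2) (G1 + G2 + crossing_edges V1 V2) \<alpha> =
    \<alpha> ^ card V2 * pair_weight V1 G1 \<alpha> + \<alpha> ^ card V1 * pair_weight V2 G2 \<alpha> +
    real (card V1) * real (card V2)"
proof -
  let ?G = "G1 + G2 + crossing_edges V1 V2"
  define E where "E V = {e. e \<subseteq> V \<and> card e = 2}" for V :: "'a set"
  define X where "X = (\<lambda>(u, v). {u, v}) ` (V1 \<times> V2)"
  have fin: "finite V1" "finite V2" using assms by (auto simp: tcm_def)
  have not_both: "\<not> (e \<subseteq> V1 \<and> e \<subseteq> V2)" if "card e = 2" for e
    using that assms(3) by (metis Int_greatest card.empty subset_empty zero_neq_numeral)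
  have out: "count G1 e = 0" if "\<not> e \<subseteq> V1" for e
    using that set_mset_tcm[OF assms(1)] by (auto simp: count_eq_zero_iff)
  have out2: "count G2 e = 0" if "\<not> e \<subseteq> V2" for e
    using that set_mset_tcm[OF assms(2)] by (auto simp: count_eq_zero_iff)
  have E: "E (V1 \<union> V2) = E V1 \<union> E V2 \<union> X"
  proof
    show "E (V1 \<union> V2) \<subseteq> E V1 \<union> E V2 \<union> X"
    proof
      fix e assume "e \<in> E (V1 \<union> V2)"
      then obtain u v where "e = {u, v}" "u \<noteq> v" "u \<in> V1 \<union> V2" "v \<in> V1 \<union> V2"
        by (auto simp: E_def card_2_iff)
      then show "e \<in> E V1 \<union> E V2 \<union> X"
        by (auto simp: E_def X_def image_iff insert_commute)
    qed
    show "E V1 \<union> E V2 \<union> X \<subseteq> E (V1 \<union> V2)"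
    proof -
      have "card {u, v} = 2" if "u \<in> V1" "v \<in> V2" for u v
        using that assms(3) by (subst card_2_iff) blast
      then show ?thesis by (auto simp: E_def X_def)
    qed
  qed
  have finE: "finite (E V1)" "finite (E V2)" "finite X"
    using fin by (auto simp: E_def X_def)
  have X: "\<not> e \<subseteq> V1" "\<not> e \<subseteq> V2" if "e \<in> X" for e
    using that assms(3) by (auto simp: X_def)
  have disj: "E V1 \<inter> E V2 = {}" "(E V1 \<union> E V2) \<inter> X = {}"
    using not_both X by (auto simp: E_def)
  have "pair_weight (V1 \<union> V2) ?G \<alpha> = (\<Sum>e\<in>E V1. \<alpha> ^ count ?G e) + (\<Sum>e\<in>E V2. \<alpha> ^ count ?G e)
      + (\<Sum>e\<in>X. \<alpha> ^ count ?G e)"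
    unfolding pair_weight_def E_def[symmetric] E using finE disj
    by (simp add: sum.union_disjoint)
  also have "(\<Sum>e\<in>E V1. \<alpha> ^ count ?G e) = (\<Sum>e\<in>E V1. \<alpha> ^ card V2 * \<alpha> ^ count G1 e)"
  proof (intro sum.cong refl)
    fix e assume "e \<in> E V1"
    then have "e \<subseteq> V1" "card e = 2" by (auto simp: E_def)
    then show "\<alpha> ^ count ?G e = \<alpha> ^ card V2 * \<alpha> ^ count G1 e"
      using count_crossing_edges_inside[OF fin assms(3)] not_both[of e] out2[of e] by (simp add: power_add)
  qed
  also have "(\<Sum>e\<in>E V2. \<alpha> ^ count ?G e) = (\<Sum>e\<in>E V2. \<alpha> ^ card V1 * \<alpha> ^ count G2 e)"
  proof (intro sum.cong refl)
    fix e assume "e \<in> E V2"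
    then have "e \<subseteq> V2" "card e = 2" by (auto simp: E_def)
    then show "\<alpha> ^ count ?G e = \<alpha> ^ card V1 * \<alpha> ^ count G2 e"
      using count_crossing_edges_inside[OF fin(2,1), of e] assms(3) not_both[of e] out[of e]
      by (simp add: power_add crossing_edges_commute[of V1] Int_commute)
  qed
  also have "(\<Sum>e\<in>X. \<alpha> ^ count ?G e) = real (card X)"
    using X fin by (simp add: out out2 count_crossing_edges_across)
  also have "card X = card V1 * card V2"
  proof -
    have "inj_on (\<lambda>(u, v). {u, v}) (V1 \<times> V2)"
      using assms(3) by (intro inj_onI) (auto simp: doubleton_eq_iff)
    then show ?thesis by (simp add: X_def card_image card_cartesian_product)
  qed
  finally show ?thesis
    by (simp add: pair_weight_def E_def sum_distrib_left)
qed

text \<open>Any subset of the right size can serve as the left part, so the induction runs over all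
  vertex sets. Dividing \<open>pair_weight_crossing\<close> by \<open>\<alpha> ^ card V\<close>
  gives exactly the recursion of \<open>split_sum\<close>.\<close>

lemma exists_two_recursive:
  assumes "finite V" "card V = leaves t" "\<alpha> > 0"
  shows "\<exists>G. two_recursive V G \<and> pair_weight V G \<alpha> = \<alpha> ^ leaves t * split_sum \<alpha> t"
  using assms(1,2)
proof (induction t arbitrary: V)
  case Tip
  then obtain v where "V = {v}" by (auto simp: card_1_singleton_iff)
  have "triples V = {}" using Tip by (simp add: triples_eq_empty)
  then have "two_recursive V {#}"
    using Tip by (intro two_recursive.base) (auto simp: tcm_def)
  moreover have "{e. e \<subseteq> V \<and> card e = 2} = {}"
    unfolding \<open>V = {v}\<close> by (auto simp: subset_singleton_iff)
  then have "pair_weight V {#} \<alpha> = 0" by (simp only: pair_weight_def sum.empty)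
  ultimately show ?case by auto
next
  case (Split l r)
  from Split.prems obtain V1 where V1: "V1 \<subseteq> V" "card V1 = leaves l"
    by (metis leaves.simps(2) le_add1 obtain_subset_with_card_n)
  define V2 where "V2 = V - V1"
  have V: "V = V1 \<union> V2" "V1 \<inter> V2 = {}" using V1 by (auto simp: V2_def)
  have fin: "finite V1" "finite V2" using Split.prems V by auto
  have V2: "card V2 = leaves r"
    using Split.prems V1 fin by (simp add: V2_def card_Diff_subset)
  obtain G1 where G1: "two_recursive V1 G1" "pair_weight V1 G1 \<alpha> = \<alpha> ^ leaves l * split_sum \<alpha> l"
    using Split.IH(1)[OF fin(1) V1(2)] by blast
  obtain G2 where G2: "two_recursive V2 G2" "pair_weight V2 G2 \<alpha> = \<alpha> ^ leaves r * split_sum \<alpha> r"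
    using Split.IH(2)[OF fin(2) V2] by blast
  note tcms = two_recursive_tcm[OF G1(1)] two_recursive_tcm[OF G2(1)]
  define G where "G = G1 + G2 + crossing_edges V1 V2"
  have tcm: "tcm V G" using tcm_crossing[OF tcms V(2)] by (simp add: G_def V)
  have ne: "V1 \<noteq> {}" "V2 \<noteq> {}" using V1 V2 leaves_pos[of l] leaves_pos[of r] by auto
  have "two_recursive V G"
  proof (cases "card V \<ge> 3")
    case True
    then show ?thesis using two_recursive.step[OF tcm True V ne G1(1) G2(1)] by (simp add: G_def)
  next
    case False
    \<comment> \<open>A split with only two leaves falls under the base rule of
      \<open>two_recursive\<close>. There are no triples then, so \<open>G\<close> is empty as that
      rule demands.\<close>
    then have "triples V = {}"
      using Split.prems(1) by (simp add: triples_eq_empty)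
    then have "G = {#}" using tcm by (auto simp: tcm_def)
    have "card V \<in> {1, 2}" using False Split.prems leaves_pos[of l] leaves_pos[of r] by auto
    then show ?thesis using tcm two_recursive.base \<open>G = {#}\<close> by blast
  qed
  moreover have "pair_weight V G \<alpha> = \<alpha> ^ leaves (Split l r) * split_sum \<alpha> (Split l r)"
  proof -
    have *: "b * (a * x) + a * (b * y) + n = a * b * (x + y + n / (a * b))"
      if "a \<noteq> 0" "b \<noteq> 0" for a b x y n :: real
      using that by (simp add: distrib_left mult.commute mult.left_commute)
    show ?thesis
      using pair_weight_crossing[OF tcms V(2), of \<alpha>] assms(3)
      unfolding G_def[symmetric] V(1)[symmetric] G1(2) G2(2) V1(2) V2 leaves.simps split_sum.simps power_add
      by (subst (asm) *) simp_all
  qed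
  ultimately show ?case by blast
qed

lemma H2_ge_split_sum:
  assumes "\<alpha> > 0"
  shows "H2 (leaves t) \<alpha> \<ge> \<alpha> ^ leaves t * split_sum \<alpha> t"
proof -
  let ?m = "leaves t"
  obtain G where G: "two_recursive {1..?m} G" "pair_weight {1..?m} G \<alpha> = \<alpha> ^ ?m * split_sum \<alpha> t"
    using exists_two_recursive[of "{1..?m}" t \<alpha>] assms by auto
  have "{G. two_recursive {1..?m} G} \<subseteq> {G. tcm {1..?m} G}"
    by (auto dest: two_recursive_tcm)
  then have "finite {G. two_recursive {1..?m} G}"
    using finite_tcms[of "{1..?m}"] finite_subset by auto
  then have "finite {weight ?m G \<alpha> | G. two_recursive {1..?m} G}" by simp
  moreover have "\<alpha> ^ ?m * split_sum \<alpha> t \<in> {weight ?m G \<alpha> | G. two_recursive {1..?m} G}"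
  proof (intro CollectI exI conjI)
    show "\<alpha> ^ ?m * split_sum \<alpha> t = weight ?m G \<alpha>"
      using G(2) by (simp only: weight_def pair_weight_def)
  qed (rule G(1))
  ultimately show ?thesis unfolding H2_def by (rule Max_ge)
qed


section \<open>Words with few inversions\<close>

text \<open>Columns are handled as lists of entries, the position in the list being the row.\<close>

definition words :: "nat set \<Rightarrow> nat \<Rightarrow> nat list set" where
  "words S n = {w. set w \<subseteq> S \<and> length w = n}"

text \<open>For \<open>a\<close> outside \<open>S\<close> these are the words with exactly one
  \<open>a\<close> and all other letters in \<open>S\<close>; the recursion asks whether the
  \<open>a\<close> comes first.\<close>

primrec words_with_one :: "nat set \<Rightarrow> nat \<Rightarrow> nat \<Rightarrow> nat list set" where
  "words_with_one S a 0 = {}"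
| "words_with_one S a (Suc n) = (#) a ` words S n \<union> (\<lambda>(s, w). s # w) ` (S \<times> words_with_one S a n)"

definition sorted_words :: "nat \<Rightarrow> nat \<Rightarrow> nat list set" where
  "sorted_words r n = {w \<in> words {0..<r} n. sorted_wrt (\<lambda>x y. \<not> (x = 0 \<and> y = 1)) w}"

definition concats :: "nat list set \<Rightarrow> nat list set \<Rightarrow> nat list set" where
  "concats X Y = (\<lambda>(x, y). x @ y) ` (X \<times> Y)"

text \<open>The three sets say where the inverted pair, a 0 before a 1, sits: within the left part,
  with no 1 on the right; within the right part, with no 0 on the left; or separated here, with its
  0 the only letter below 2 on the left and its 1 the only one on the right. A single leaf has no
  pair.\<close>

primrec inverted_words :: "nat \<Rightarrow> split_tree \<Rightarrow> nat list set" where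
  "inverted_words r Tip = {}"
| "inverted_words r (Split l t) =
     concats (inverted_words r l) (words ({0..<r} - {1}) (leaves t)) \<union>
     concats (words {1..<r} (leaves l)) (inverted_words r t) \<union>
     concats (words_with_one {2..<r} 0 (leaves l)) (words_with_one {2..<r} 1 (leaves t))"

section \<open>Counting sorted and inverted words\<close>

lemma card_words: "finite S \<Longrightarrow> card (words S n) = card S ^ n"
  by (simp add: words_def card_lists_length_eq)

lemma finite_words: "finite S \<Longrightarrow> finite (words S n)"
  by (simp add: words_def finite_lists_length_eq)

lemma words_mono: "S \<subseteq> T \<Longrightarrow> words S n \<subseteq> words T n"
  by (auto simp: words_def)

lemma words_with_one_subset: "words_with_one S a n \<subseteq> words (insert a S) n"
proof (induction n)
  case (Suc n)
  have "w \<in> words (insert a S) n" if "w \<in> words_with_one S a n" for w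
    using that Suc.IH by blast
  then show ?case by (fastforce simp: words_def)
qed simp

lemma words_with_one_mem: "w \<in> words_with_one S a n \<Longrightarrow> a \<in> set w"
  by (induction n arbitrary: w) auto

lemma words_with_one_unique:
  assumes "w \<in> words_with_one S a n" "a \<notin> S" "i < n" "j < n" "w ! i = a" "w ! j = a"
  shows "i = j"
  using assms
proof (induction n arbitrary: w i j)
  case (Suc n)
  from Suc.prems(1) consider v where "w = a # v" "v \<in> words S n"
    | s v where "w = s # v" "s \<in> S" "v \<in> words_with_one S a n"
    by auto
  then show ?case
  proof cases
    case 1
    have "w ! k \<noteq> a" if "0 < k" "k < Suc n" for k
    proof -
      have "length v = n" "set v \<subseteq> S" using 1(2) by (simp_all add: words_def)
      then have "v ! (k - 1) \<in> S" using that nth_mem[of "k - 1" v] by (simp add: subset_iff)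
      with Suc.prems(2) show ?thesis using 1(1) that by (metis nth_Cons_pos)
    qed
    then show ?thesis using Suc.prems(3-6) by (metis gr0I)
  next
    case 2
    have "s \<noteq> a" using 2(2) Suc.prems(2) by blast
    then obtain i' j' where ij: "i = Suc i'" "j = Suc j'"
      using Suc.prems(5,6) 2(1) by (cases i; cases j) auto
    then have "i' = j'" using Suc.IH[OF 2(3) Suc.prems(2), of i' j'] Suc.prems(3-6) 2(1) by simp
    then show ?thesis using ij by simp
  qed
qed simp

text \<open>There are \<open>n\<close> places for \<open>a\<close>, and the other
  \<open>n - 1\<close> letters are free in \<open>S\<close>. For \<open>n = 0\<close> the factor
  \<open>n\<close> makes the truncated exponent harmless.\<close>

lemma card_words_with_one:
  assumes "finite S" "a \<notin> S"
  shows "card (words_with_one S a n) = n * card S ^ (n - 1)"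
proof (induction n)
  case (Suc n)
  have fin: "finite (words S n)" "finite (words_with_one S a n)"
    using assms(1) finite_subset[OF words_with_one_subset finite_words] by (simp_all add: finite_words)
  have "(#) a ` words S n \<inter> (\<lambda>(s, w). s # w) ` (S \<times> words_with_one S a n) = {}"
    using assms(2) by auto
  then have "card (words_with_one S a (Suc n)) =
      card ((#) a ` words S n) + card ((\<lambda>(s, w). s # w) ` (S \<times> words_with_one S a n))"
    using fin assms(1) by (simp add: card_Un_disjoint)
  also have "card ((#) a ` words S n) = card S ^ n"
    using assms(1) by (simp add: card_image card_words)
  also have "card ((\<lambda>(s, w). s # w) ` (S \<times> words_with_one S a n)) = card S * (n * card S ^ (n - 1))"
    by (subst card_image) (auto simp: inj_on_def card_cartesian_product Suc.IH)
  also have "card S ^ n + card S * (n * card S ^ (n - 1)) = Suc n * card S ^ (Suc n - 1)"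
    by (cases n) (simp_all add: distrib_left mult.left_commute)
  finally show ?case .
qed simp

text \<open>A leading 0 forbids any later 1, and a word without 1 is sorted anyway. Any other
  leading letter imposes no condition on the rest.\<close>

lemma sorted_words_Suc:
  assumes "0 < r"
  shows "sorted_words r (Suc n) =
    (#) 0 ` words ({0..<r} - {1}) n \<union> (\<lambda>(s, w). s # w) ` ({1..<r} \<times> sorted_words r n)"
    (is "?L = ?R")
proof (rule Set.set_eqI)
  fix w
  show "w \<in> ?L \<longleftrightarrow> w \<in> ?R"
  proof (cases w)
    case Nil
    then show ?thesis by (auto simp: sorted_words_def words_def)
  next
    case (Cons s v)
    have "sorted_wrt (\<lambda>x y. \<not> (x = 0 \<and> y = 1)) v" if "1 \<notin> set v"
      using that by (induction v) auto
    then have "s # v \<in> ?L \<longleftrightarrow> (if s = 0 then v \<in> words ({0..<r} - {1}) n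
        else s < r \<and> v \<in> sorted_words r n)"
      using assms by (auto simp: sorted_words_def words_def subset_Diff_insert)
    also have "\<dots> \<longleftrightarrow> s # v \<in> ?R" by (auto simp: image_iff)
    finally show ?thesis by (simp only: Cons)
  qed
qed

text \<open>By the first letter, the numbers satisfy f(n+1) = (r-1)^n + (r-1) f(n) with f(0) = 1.
  They supply the terms of the final bound that do not involve \<open>lambda_series\<close>.\<close>

lemma card_sorted_words:
  assumes "r \<ge> 2"
  shows "card (sorted_words r n) = n * (r - 1) ^ (n - 1) + (r - 1) ^ n"
proof (induction n)
  case 0
  have "sorted_words r 0 = {[]}" by (auto simp: sorted_words_def words_def)
  then show ?case by simp
next
  case (Suc n)
  have fin: "finite (sorted_words r n)" by (simp add: sorted_words_def finite_words)
  have "(#) 0 ` words ({0..<r} - {1}) n \<inter> (\<lambda>(s, w). s # w) ` ({1..<r} \<times> sorted_words r n) = {}"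
    by auto
  then have "card (sorted_words r (Suc n)) = card ((#) 0 ` words ({0..<r} - {1}) n) +
      card ((\<lambda>(s, w). s # w) ` ({1..<r} \<times> sorted_words r n))"
    using fin assms by (simp add: sorted_words_Suc card_Un_disjoint finite_words)
  also have "card ((#) 0 ` words ({0..<r} - {1}) n) = (r - 1) ^ n"
    using assms by (simp add: card_image card_words)
  also have "card ((\<lambda>(s, w). s # w) ` ({1..<r} \<times> sorted_words r n)) =
      (r - 1) * (n * (r - 1) ^ (n - 1) + (r - 1) ^ n)"
    by (subst card_image) (auto simp: inj_on_def card_cartesian_product Suc.IH)
  also have "(r - 1) ^ n + (r - 1) * (n * (r - 1) ^ (n - 1) + (r - 1) ^ n) =
      Suc n * (r - 1) ^ (Suc n - 1) + (r - 1) ^ Suc n"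
  proof -
    have "p ^ n + p * (n * p ^ (n - 1) + p ^ n) = Suc n * p ^ (Suc n - 1) + p ^ Suc n" for p :: nat
      by (cases n) (simp_all add: algebra_simps)
    then show ?thesis .
  qed
  finally show ?case .
qed

lemma concats_subset_words:
  "X \<subseteq> words S m \<Longrightarrow> Y \<subseteq> words S n \<Longrightarrow> concats X Y \<subseteq> words S (m + n)"
  by (force simp: concats_def words_def)

text \<open>The common length of the words in \<open>X\<close> determines where a concatenation is
  to be cut.\<close>

lemma card_concats:
  assumes "X \<subseteq> words S n"
  shows "card (concats X Y) = card X * card Y"
proof -
  have "inj_on (\<lambda>(x, y). x @ y) (X \<times> Y)"
  proof -
    have "length x = n" if "x \<in> X" for x using that assms by (auto simp: words_def)
    then show ?thesis by (auto simp: inj_on_def)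
  qed
  then show ?thesis by (simp add: concats_def card_image card_cartesian_product)
qed

lemma inverted_words_subset:
  assumes "2 \<le> r"
  shows "inverted_words r t \<subseteq> words {0..<r} (leaves t)"
proof (induction t)
  case (Split l t)
  have "words ({0..<r} - {1}) n \<subseteq> words {0..<r} n" "words {1..<r} n \<subseteq> words {0..<r} n" for n
    by (auto intro!: words_mono)
  moreover have "words_with_one {2..<r} a n \<subseteq> words {0..<r} n" if "a < r" for a n
    by (rule order_trans[OF words_with_one_subset words_mono]) (use that in auto)
  ultimately show ?case
    using Split assms by (simp add: concats_subset_words)
qed simp

text \<open>This keeps the two families of columns disjoint, so that their cardinalities add
  up.\<close>

lemma inverted_words_not_sorted:
  "w \<in> inverted_words r t \<Longrightarrow> \<not> sorted_wrt (\<lambda>x y. \<not> (x = 0 \<and> y = 1)) w"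
proof (induction t arbitrary: w)
  case (Split l t)
  then consider x y where "w = x @ y" "x \<in> inverted_words r l"
    | x y where "w = x @ y" "y \<in> inverted_words r t"
    | x y where "w = x @ y" "0 \<in> set x" "1 \<in> set y"
    by (fastforce simp: concats_def dest: words_with_one_mem)
  then show ?case
    by cases (use Split.IH in \<open>auto simp: sorted_wrt_append\<close>)
qed simp

lemma inverted_words_mem:
  assumes "w \<in> inverted_words r t"
  shows "0 \<in> set w" "1 \<in> set w"
proof -
  obtain i j where "i < j" "j < length w" "w ! i = 0" "w ! j = 1"
    using inverted_words_not_sorted[OF assms] by (auto simp: sorted_wrt_iff_nth_less)
  then show "0 \<in> set w" "1 \<in> set w" by (metis nth_mem order.strict_trans)+
qed

text \<open>The three sets in the recursion are disjoint. With a and b leaves in the two parts, the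
  third has a b (r-2)^(a+b-2) elements, which is (r-1)^(a+b) / (r-2)^2 times the root term of
  \<open>split_sum\<close> at \<alpha> = (r-1)/(r-2). The other two match the subtrees.\<close>

lemma card_inverted_words:
  assumes "3 \<le> r"
  shows "real (card (inverted_words r t)) =
    (real r - 1) ^ leaves t / (real r - 2) ^ 2 * split_sum ((real r - 1) / (real r - 2)) t"
proof (induction t)
  case (Split l t)
  let ?a = "leaves l" and ?b = "leaves t"
  define A where "A = concats (inverted_words r l) (words ({0..<r} - {1}) ?b)"
  define B where "B = concats (words {1..<r} ?a) (inverted_words r t)"
  define C where "C = concats (words_with_one {2..<r} 0 ?a) (words_with_one {2..<r} 1 ?b)"
  \<comment> \<open>The left part of a word in \<open>A\<close> contains a 0, that of a word in
    \<open>B\<close> does not.\<close>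
  have AB: "A \<inter> B = {}"
  proof -
    have False if "w \<in> A" "w \<in> B" for w
    proof -
      from that(1) obtain x y where w: "w = x @ y" "x \<in> inverted_words r l"
        by (auto simp: A_def concats_def)
      from that(2) obtain x' y' where w': "w = x' @ y'" "x' \<in> words {1..<r} ?a"
        by (auto simp: B_def concats_def)
      have "length x = length x'"
        using w(2) w'(2) assms inverted_words_subset[of r l] by (auto simp: words_def)
      then have "x = x'" using w w' by simp
      moreover have "0 \<notin> set x'" using w'(2) by (auto simp: words_def)
      ultimately show False using inverted_words_mem[OF w(2)] by simp
    qed
    then show ?thesis by blast
  qed
  \<comment> \<open>A word in \<open>C\<close> has no 1 on the left and no 0 on the right, so
    neither part is an inverted word.\<close>
  have ABC: "(A \<union> B) \<inter> C = {}"
  proof -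
    have False if "w \<in> A \<union> B" "w \<in> C" for w
    proof -
      from that(2) obtain x y where w: "w = x @ y" "x \<in> words_with_one {2..<r} 0 ?a" "y \<in> words_with_one {2..<r} 1 ?b"
        by (auto simp: C_def concats_def)
      have xy: "length x = ?a" "1 \<notin> set x" "0 \<in> set x" "0 \<notin> set y"
        using w(2,3) words_with_one_subset[of "{2..<r}" 0 ?a] words_with_one_subset[of "{2..<r}" 1 ?b] words_with_one_mem
        by (fastforce simp: words_def)+
      from that(1) obtain x' y' where w': "w = x' @ y'" "length x' = ?a"
        "x' \<in> inverted_words r l \<or> x' \<in> words {1..<r} ?a \<and> y' \<in> inverted_words r t"
        using inverted_words_subset[of r l] assms by (fastforce simp: A_def B_def concats_def words_def)
      have "x' = x" "y' = y" using w(1) w'(1,2) xy(1) by auto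
      then show False using w'(3) xy inverted_words_mem by (auto simp: words_def)
    qed
    then show ?thesis by blast
  qed
  have fin: "finite (inverted_words r t)" for t
    by (rule finite_subset[OF inverted_words_subset finite_words]) (use assms in auto)
  have fin_single: "finite (words_with_one {2..<r} a n)" for a n
    by (rule finite_subset[OF words_with_one_subset finite_words]) simp
  have finABC: "finite A" "finite B" "finite C"
    by (auto simp: A_def B_def C_def concats_def fin finite_words fin_single)
  have "card (inverted_words r (Split l t)) = card A + card B + card C"
    unfolding inverted_words.simps A_def[symmetric] B_def[symmetric] C_def[symmetric]
    using AB ABC finABC by (simp add: card_Un_disjoint)
  also have "card A = card (inverted_words r l) * (r - 1) ^ ?b"
    unfolding A_def using assms inverted_words_subset[of r l]
    by (subst card_concats) (auto simp: card_words)
  also have "card B = (r - 1) ^ ?a * card (inverted_words r t)"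
    unfolding B_def by (subst card_concats[OF order_refl]) (simp add: card_words)
  also have "card C = (?a * (r - 2) ^ (?a - 1)) * (?b * (r - 2) ^ (?b - 1))"
    unfolding C_def by (subst card_concats[OF words_with_one_subset]) (simp add: card_words_with_one)
  finally have card: "card (inverted_words r (Split l t)) = card (inverted_words r l) * (r - 1) ^ ?b +
      (r - 1) ^ ?a * card (inverted_words r t) + (?a * (r - 2) ^ (?a - 1)) * (?b * (r - 2) ^ (?b - 1))" .
  define p q where "p = real r - 1" and "q = real r - 2"
  have pq: "p > 0" "q > 0" "real (r - 1) = p" "real (r - 2) = q"
    using assms by (auto simp: p_def q_def of_nat_diff)
  \<comment> \<open>Since trees have leaves, the truncated exponent is a genuine predecessor; the
    two divisions by \<open>q\<close> produce the denominator \<open>q ^ 2\<close>.\<close>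
  have q_power: "q ^ (n - 1) = q ^ n / q" if "n > 0" for n
    using pq(2) that by (cases n) auto
  have "real (card (inverted_words r (Split l t))) =
      (p ^ ?a / q ^ 2 * split_sum (p / q) l) * p ^ ?b + p ^ ?a * (p ^ ?b / q ^ 2 * split_sum (p / q) t) +
      (real ?a * (q ^ ?a / q)) * (real ?b * (q ^ ?b / q))"
    using Split.IH unfolding card of_nat_add of_nat_mult of_nat_power pq p_def[symmetric] q_def[symmetric]
    by (simp only: q_power leaves_pos)
  also have "\<dots> = p ^ ?a * p ^ ?b / q ^ 2 * (split_sum (p / q) l + split_sum (p / q) t +
      real ?a * real ?b / (p ^ ?a * p ^ ?b / (q ^ ?a * q ^ ?b)))"
    using pq(1,2) by (simp add: field_simps power2_eq_square)
  finally show ?case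
    by (simp add: p_def[symmetric] q_def[symmetric] power_add power_divide)
qed simp

section \<open>Patterns avoided by sorted and inverted words\<close>

text \<open>The three ways to build an inverted word, restated by positions: the pattern arguments
  below compare indices with the cut \<open>n\<close>. The bound \<open>N\<close> keeps indices
  inside the word.\<close>

lemma inverted_words_SplitD:
  fixes l t :: split_tree
  defines "n \<equiv> leaves l" and "N \<equiv> leaves l + leaves t"
  assumes "w \<in> inverted_words r (Split l t)" "2 \<le> r"
  obtains "take n w \<in> inverted_words r l" "\<And>k. n \<le> k \<Longrightarrow> k < N \<Longrightarrow> w ! k \<noteq> 1"
  | "drop n w \<in> inverted_words r t" "\<And>k. k < n \<Longrightarrow> w ! k \<noteq> 0"
  | "\<And>k. k < n \<Longrightarrow> w ! k \<noteq> 1" "\<And>k. n \<le> k \<Longrightarrow> k < N \<Longrightarrow> w ! k \<noteq> 0"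
    "\<And>i j. i < n \<Longrightarrow> j < n \<Longrightarrow> w ! i = 0 \<Longrightarrow> w ! j = 0 \<Longrightarrow> i = j"
    "\<And>i j. n \<le> i \<Longrightarrow> i < N \<Longrightarrow> n \<le> j \<Longrightarrow> j < N \<Longrightarrow> w ! i = 1 \<Longrightarrow> w ! j = 1 \<Longrightarrow> i = j"
proof -
  from assms(3) consider x y where "w = x @ y" "x \<in> inverted_words r l" "y \<in> words ({0..<r} - {1}) (leaves t)"
    | x y where "w = x @ y" "x \<in> words {1..<r} n" "y \<in> inverted_words r t"
    | x y where "w = x @ y" "x \<in> words_with_one {2..<r} 0 n" "y \<in> words_with_one {2..<r} 1 (leaves t)"
    by (auto simp: concats_def n_def)
  then show thesis
  proof cases
    case 1
    have len: "length x = n" "length y = leaves t"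
      using 1 inverted_words_subset[OF assms(4), of l] by (auto simp: words_def n_def)
    have "w ! k \<noteq> 1" if "n \<le> k" "k < N" for k
    proof -
      have "w ! k \<in> set y" using that len by (auto simp: 1(1) nth_append n_def N_def)
      then show ?thesis using 1(3) by (auto simp: words_def)
    qed
    then show thesis using that(1) 1 len by simp
  next
    case 2
    have len: "length x = n" using 2 by (auto simp: words_def)
    have "w ! k \<noteq> 0" if "k < n" for k
    proof -
      have "w ! k \<in> set x" using that len by (auto simp: 2(1) nth_append)
      then show ?thesis using 2(2) by (auto simp: words_def)
    qed
    then show thesis using that(2) 2 len by simp
  next
    case 3
    have x: "x \<in> words (insert 0 {2..<r}) n" and y: "y \<in> words (insert 1 {2..<r}) (leaves t)"
      using 3(2,3) words_with_one_subset by blast+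
    have len: "length x = n" "length y = leaves t" using x y by (auto simp: words_def)
    have wx: "w ! k = x ! k" if "k < n" for k using that len by (simp add: 3(1) nth_append)
    have wy: "w ! k = y ! (k - n)" if "n \<le> k" for k using that len by (simp add: 3(1) nth_append)
    show thesis
    proof (rule that(3))
      fix k assume "k < n"
      then have "w ! k \<in> set x" using wx len by simp
      then show "w ! k \<noteq> 1" using x by (auto simp: words_def)
    next
      fix k assume "n \<le> k" "k < N"
      then have "w ! k \<in> set y" using wy[of k] len by (simp add: n_def N_def)
      then show "w ! k \<noteq> 0" using y by (auto simp: words_def)
    next
      fix i j assume "i < n" "j < n" "w ! i = 0" "w ! j = 0"
      then show "i = j" using words_with_one_unique[OF 3(2), of i j] wx by simp
    next
      fix i j assume ij: "n \<le> i" "i < N" "n \<le> j" "j < N" "w ! i = 1" "w ! j = 1"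
      then have "i - n = j - n"
        using words_with_one_unique[OF 3(3), of "i - n" "j - n"] wy[of i] wy[of j] by (simp add: n_def N_def)
      then show "i = j" using ij by simp
    qed
  qed
qed

text \<open>If the inverted pair lies in one part, the letters excluded from the other part force
  \<open>i\<close> and \<open>k\<close> into that part too, and induction applies. If it is
  separated here, \<open>i\<close> is the only 0 and \<open>k\<close> the only 1, so nothing between
  them is 0 or 1.\<close>

lemma inverted_words_between:
  assumes "2 \<le> r" "w \<in> inverted_words r t" "i < j" "j < k" "k < leaves t" "w ! i = 0" "w ! k = 1"
  shows "w ! j \<noteq> 0 \<and> w ! j \<noteq> 1"
  using assms(2-)
proof (induction t arbitrary: w i j k)
  case (Split l t)
  define n where "n = leaves l"
  define N where "N = leaves l + leaves t"
  have lt: "i < N" "j < N" "k < N" using Split.prems by (auto simp: N_def)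
  from Split.prems(1) assms(1) show ?case
  proof (cases rule: inverted_words_SplitD)
    case 1
    have "k < n" using 1(2)[of k] lt(3) Split.prems(6) by (force simp: n_def N_def)
    then show ?thesis
      using Split.IH(1)[OF 1(1), of i j k] Split.prems(2-) by (simp add: n_def)
  next
    case 2
    have "n \<le> i" using 2(2)[of i] Split.prems(5) by (force simp: n_def)
    then obtain i' j' k' where "i = n + i'" "j = n + j'" "k = n + k'"
      using Split.prems(2,3) by (metis le_Suc_ex less_imp_le order.trans)
    moreover have "length w = N"
      using Split.prems(1) inverted_words_subset[OF assms(1), of "Split l t"]
      by (auto simp: N_def words_def simp del: inverted_words.simps)
    then have "drop (leaves l) w ! m = w ! (n + m)" for m
      by (simp add: n_def N_def)
    ultimately show ?thesis
      using Split.IH(2)[OF 2(1), of i' j' k'] Split.prems(2-) by (simp add: n_def)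
  next
    case 3
    have "i < n" using 3(2)[of i] lt(1) Split.prems(5) by (force simp: n_def N_def)
    moreover have "n \<le> k" using 3(1)[of k] Split.prems(6) by (force simp: n_def)
    ultimately show ?thesis
      using 3(1)[of j] 3(2)[of j] 3(3)[of i j] 3(4)[of j k] lt Split.prems(2-)
      by (cases "j < n") (auto simp: n_def N_def)
  qed
qed simp

lemma inverted_words_alternating:
  assumes "2 \<le> r" "x \<in> inverted_words r t" "y \<in> inverted_words r t" "i < j" "j < k" "k < leaves t"
    "x ! i = 1" "x ! j = 0" "x ! k = 1" "y ! i = 0" "y ! j = 1" "y ! k = 0"
  shows False
  using assms(2-)
proof (induction t arbitrary: x y i j k)
  case (Split l t)
  define n where "n = leaves l"
  define N where "N = leaves l + leaves t"
  have lt: "i < N" "j < N" "k < N" using Split.prems(3-5) by (auto simp: N_def)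
  have len: "length w = N" if "w \<in> inverted_words r (Split l t)" for w
    using that inverted_words_subset[OF assms(1), of "Split l t"]
    by (auto simp: N_def words_def simp del: inverted_words.simps)
  consider "k < n" | "j < n" "n \<le> k" | "i < n" "n \<le> j" | "n \<le> i" by linarith
  then show ?case
  proof cases
    case 1
    then have lt': "i < n" "j < n" using Split.prems(3,4) by auto
    have "take n x \<in> inverted_words r l"
      using Split.prems(1) assms(1)
    proof (cases rule: inverted_words_SplitD)
      case 2
      show ?thesis using 2(2)[of j] lt' Split.prems(3,4,6-) by (simp add: n_def)
    next
      case 3
      show ?thesis using 3(1)[of i] lt' Split.prems(3,4,6-) by (simp add: n_def)
    qed (simp add: n_def)
    moreover have "take n y \<in> inverted_words r l"
      using Split.prems(2) assms(1)
    proof (cases rule: inverted_words_SplitD)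
      case 2
      show ?thesis using 2(2)[of i] lt' Split.prems(3,4,6-) by (simp add: n_def)
    next
      case 3
      show ?thesis using 3(1)[of j] lt' Split.prems(3,4,6-) by (simp add: n_def)
    qed (simp add: n_def)
    ultimately show ?thesis
      using Split.IH(1)[of "take n x" "take n y" i j k] 1 Split.prems(3-) by (simp add: n_def)
  next
    case 2
    from Split.prems(1) assms(1) show ?thesis
    proof (cases rule: inverted_words_SplitD)
      case 1
      show ?thesis using 1(2)[of k] 2 lt Split.prems(3,4,6-) by (simp add: n_def N_def)
    next
      case a: 2
      show ?thesis using a(2)[of j] 2 Split.prems(3,4,6-) by (simp add: n_def)
    next
      case 3
      show ?thesis using 3(1)[of i] 2 Split.prems(3,4,6-) by (simp add: n_def)
    qed
  next
    case 3
    from Split.prems(2) assms(1) show ?thesis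
    proof (cases rule: inverted_words_SplitD)
      case 1
      show ?thesis using 1(2)[of j] 3 lt Split.prems(3,4,6-) by (simp add: n_def N_def)
    next
      case 2
      show ?thesis using 2(2)[of i] 3 Split.prems(3,4,6-) by (simp add: n_def)
    next
      case a: 3
      show ?thesis using a(2)[of k] 3 lt Split.prems(3,4,6-) by (simp add: n_def N_def)
    qed
  next
    case 4
    then have ge: "n \<le> j" "n \<le> k" using Split.prems(3,4) by auto
    have "drop n x \<in> inverted_words r t"
      using Split.prems(1) assms(1)
    proof (cases rule: inverted_words_SplitD)
      case 1
      show ?thesis using 1(2)[of i] 4 lt Split.prems(6) by (simp add: n_def N_def)
    next
      case 3
      show ?thesis using 3(2)[of j] ge lt Split.prems(7) by (simp add: n_def N_def)
    qed (simp add: n_def)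
    moreover have "drop n y \<in> inverted_words r t"
      using Split.prems(2) assms(1)
    proof (cases rule: inverted_words_SplitD)
      case 1
      show ?thesis using 1(2)[of j] ge lt Split.prems(3,4,6-) by (simp add: n_def N_def)
    next
      case 3
      show ?thesis using 3(2)[of i] 4 lt Split.prems(3,4,6-) by (simp add: n_def N_def)
    qed (simp add: n_def)
    moreover obtain i' j' k' where ijk: "i = n + i'" "j = n + j'" "k = n + k'"
      using le_Suc_ex[OF 4] le_Suc_ex[OF ge(1)] le_Suc_ex[OF ge(2)] by blast
    moreover have "drop n x ! m = x ! (n + m)" "drop n y ! m = y ! (n + m)" for m
      using len[OF Split.prems(1)] len[OF Split.prems(2)] by (simp_all add: n_def N_def)
    ultimately show ?thesis
      using Split.IH(2)[of "drop n x" "drop n y" i' j' k'] Split.prems(3-) by (simp add: n_def del: nth_drop)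
  qed
qed simp

lemma sorted_Un_inverted_no_M:
  assumes "2 \<le> r" "x \<in> sorted_words r (leaves t) \<union> inverted_words r t"
    "y \<in> sorted_words r (leaves t) \<union> inverted_words r t"
    "u < leaves t" "v < leaves t" "w < leaves t" "u \<noteq> v" "u \<noteq> w" "v \<noteq> w"
    "x ! u = 0" "x ! v = 0" "x ! w = 1" "y ! u = 1" "y ! v = 1" "y ! w = 0"
  shows False
  using assms(4-)
proof (induction u v rule: linorder_wlog)
  case (le u v)
  have inv: "z \<in> inverted_words r t"
    if "z \<in> sorted_words r (leaves t) \<union> inverted_words r t" "i < j" "j < leaves t" "z ! i = 0" "z ! j = 1" for z i j
  proof -
    have "\<not> sorted_wrt (\<lambda>x y. \<not> (x = 0 \<and> y = 1)) z" if "length z = leaves t"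
      using sorted_wrt_nth_less[of _ z i j] that \<open>i < j\<close> \<open>j < leaves t\<close> \<open>z ! i = 0\<close> \<open>z ! j = 1\<close>
      by metis
    then show ?thesis using that(1) by (auto simp: sorted_words_def words_def)
  qed
  consider "u < v" "v < w" | "w < u" "u < v" | "u < w" "w < v" using le by linarith
  then show ?case
  proof cases
    case 1
    then have "x \<in> inverted_words r t" using inv[OF assms(2), of v w] le by simp
    then show ?thesis using inverted_words_between[OF assms(1), of x t u v w] 1 le by simp
  next
    case 2
    then have "y \<in> inverted_words r t" using inv[OF assms(3), of w u] le by simp
    then show ?thesis using inverted_words_between[OF assms(1), of y t w u v] 2 le by simp
  next
    case 3
    then have "x \<in> inverted_words r t" "y \<in> inverted_words r t"
      using inv[OF assms(2), of u w] inv[OF assms(3), of w v] le by simp_all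
    then show ?thesis using inverted_words_alternating[OF assms(1), of y t x u w v] 3 le by simp
  qed
next
  case (sym u v)
  then show ?case by blast
qed

section \<open>Matrices without a configuration of M\<close>

lemma contains_configurationE:
  assumes "contains_configuration A F"
  obtains f g where "inj_on f {..<dim_row F}" "\<And>i. i < dim_row F \<Longrightarrow> f i < dim_row A"
    "\<And>j. j < dim_col F \<Longrightarrow> g j < dim_col A"
    "\<And>i j. i < dim_row F \<Longrightarrow> j < dim_col F \<Longrightarrow> A $$ (f i, g j) = F $$ (i, j)"
proof -
  from assms obtain I J p q where p: "p permutes {0..<dim_row F}" and q: "q permutes {0..<dim_col F}"
    and eq: "submatrix A I J = mat (dim_row F) (dim_col F) (\<lambda>(i, j). F $$ (p i, q j))"
    by (auto simp: contains_configuration_def)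
  define f where "f i = pick I (inv_into UNIV p i)" for i
  define g where "g j = pick J (inv_into UNIV q j)" for j
  have rows: "card {i. i < dim_row A \<and> i \<in> I} = dim_row F"
    using arg_cong[OF eq, of dim_row] by (simp add: dim_submatrix)
  have cols: "card {j. j < dim_col A \<and> j \<in> J} = dim_col F"
    using arg_cong[OF eq, of dim_col] by (simp add: dim_submatrix)
  have ip: "inv_into UNIV p i < dim_row F" if "i < dim_row F" for i
    using that permutes_in_image[OF permutes_inv[OF p], of i] by simp
  have iq: "inv_into UNIV q j < dim_col F" if "j < dim_col F" for j
    using that permutes_in_image[OF permutes_inv[OF q], of j] by simp
  have pick_inj: "a = b" if "a < dim_row F" "b < dim_row F" "pick I a = pick I b" for a b
  proof (cases "finite I")
    case True
    have "dim_row F \<le> card I" using card_mono[OF True, of "{i. i < dim_row A \<and> i \<in> I}"] rows by auto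
    then show ?thesis
      using that pick_mono_le[of a I b] pick_mono_le[of b I a] by (cases a b rule: linorder_cases) auto
  next
    case False
    then show ?thesis using that(3) pick_eq_iff_inf by blast
  qed
  show thesis
  proof (rule that)
    show "inj_on f {..<dim_row F}"
    proof (rule inj_onI)
      fix a b assume "a \<in> {..<dim_row F}" "b \<in> {..<dim_row F}" "f a = f b"
      then have "inv_into UNIV p a = inv_into UNIV p b"
        using pick_inj ip by (simp add: f_def)
      then show "a = b" using permutes_inj[OF permutes_inv[OF p]] by (simp add: inj_eq)
    qed
    show "f i < dim_row A" if "i < dim_row F" for i
      using pick_le[of "inv_into UNIV p i" "dim_row A" I] ip[OF that] rows by (simp add: f_def)
    show "g j < dim_col A" if "j < dim_col F" for j
      using pick_le[of "inv_into UNIV q j" "dim_col A" J] iq[OF that] cols by (simp add: g_def)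
    show "A $$ (f i, g j) = F $$ (i, j)" if "i < dim_row F" "j < dim_col F" for i j
    proof -
      have "A $$ (f i, g j) = submatrix A I J $$ (inv_into UNIV p i, inv_into UNIV q j)"
        using ip[OF that(1)] iq[OF that(2)] rows cols by (simp add: submatrix_index f_def g_def)
      also have "\<dots> = F $$ (p (inv_into UNIV p i), q (inv_into UNIV q j))"
        using ip[OF that(1)] iq[OF that(2)] by (simp add: eq)
      finally show ?thesis using permutes_inverses(1)[OF p] permutes_inverses(1)[OF q] by simp
    qed
  qed
qed

lemma finite_forb_set:
  "finite {dim_col A | A. dim_row A = m \<and> r_matrix r A \<and> simple_matrix A \<and> \<not> contains_configuration A F}"
    (is "finite ?D")
proof (rule finite_subset)
  show "?D \<subseteq> {..r ^ m}"
  proof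
    fix d assume "d \<in> ?D"
    then obtain A where A: "d = dim_col A" "dim_row A = m" "r_matrix r A" "distinct (cols A)"
      by (auto simp: simple_matrix_def)
    have "set (cols A) \<subseteq> vec_of_list ` words {0..<r} m"
    proof
      fix v assume "v \<in> set (cols A)"
      then obtain j where j: "j < dim_col A" "v = col A j" by (auto simp: cols_def)
      have "A $$ (i, j) < r" if "i < m" for i
      proof -
        have "A $$ (i, j) \<in> elements_mat A"
          using A(2) by (intro elements_matI[OF carrier_matI that j(1)]) simp_all
        then show ?thesis using A(3) by (auto simp: r_matrix_def)
      qed
      then have "vec_set v \<subseteq> {0..<r}"
        using A(2) j by (auto simp: vec_set_def)
      then have "list_of_vec v \<in> words {0..<r} m"
        using A(2) j by (simp add: words_def set_list_of_vec)
      then show "v \<in> vec_of_list ` words {0..<r} m"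
        by (rule image_eqI[of v vec_of_list "list_of_vec v", rotated]) (simp add: vec_list)
    qed
    then have "card (set (cols A)) \<le> card (vec_of_list ` words {0..<r} m)"
      by (intro card_mono finite_imageI finite_words) auto
    also have "\<dots> \<le> card (words {0..<r} m)" by (intro card_image_le finite_words) auto
    also have "\<dots> = r ^ m" by (simp add: card_words)
    finally show "d \<in> {..r ^ m}" using A by (simp add: distinct_card)
  qed
qed simp

lemma forb_M_ge_card:
  assumes "C \<subseteq> words {0..<r} m"
    and no_M: "\<And>x y u v w. \<lbrakk>x \<in> C; y \<in> C; u < m; v < m; w < m; u \<noteq> v; u \<noteq> w; v \<noteq> w;
      x ! u = 0; x ! v = 0; x ! w = 1; y ! u = 1; y ! v = 1; y ! w = 0\<rbrakk> \<Longrightarrow> False"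
  shows "card C \<le> forb m r M_matrix"
proof -
  have "finite C" by (rule finite_subset[OF assms(1) finite_words]) simp
  then obtain ws where ws: "set ws = C" "distinct ws" using finite_distinct_list by blast
  define A where "A = mat_of_cols m (map vec_of_list ws)"
  have len: "length w = m" "set w \<subseteq> {0..<r}" if "w \<in> set ws" for w
    using that ws(1) assms(1) by (auto simp: words_def)
  have A: "dim_row A = m" "dim_col A = length ws"
    by (simp_all add: A_def)
  have entry: "A $$ (i, j) = ws ! j ! i" if "i < m" "j < length ws" for i j
    using that by (simp add: A_def mat_of_cols_index vec_of_list_index)
  have "cols A = map vec_of_list ws"
    unfolding A_def
  proof (intro cols_mat_of_cols subsetI)
    fix v assume "v \<in> set (map vec_of_list ws)"
    then obtain w where w: "w \<in> set ws" "v = vec_of_list w" by auto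
    show "v \<in> carrier_vec m"
      unfolding w(2) using len(1)[OF w(1)] by (intro carrier_vecI) simp
  qed
  moreover have "inj_on vec_of_list (set ws)"
    by (rule inj_on_inverseI[of _ list_of_vec]) (rule list_vec)
  ultimately have "simple_matrix A"
    using ws(2) by (simp add: simple_matrix_def distinct_map)
  moreover have "r_matrix r A"
    unfolding r_matrix_def
  proof
    fix a assume "a \<in> elements_mat A"
    then obtain i j where ij: "i < m" "j < length ws" "a = A $$ (i, j)" using A by auto
    then have "a \<in> set (ws ! j)" using entry len(1)[of "ws ! j"] by simp
    then show "a \<in> {0..<r}" using len(2)[of "ws ! j"] ij(2) by auto
  qed
  moreover have "\<not> contains_configuration A M_matrix"
  proof
    assume conf: "contains_configuration A M_matrix"
    have M: "dim_row M_matrix = 3" "dim_col M_matrix = 2"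
      by (simp_all add: M_matrix_def mat_of_rows_list_def)
    obtain f g where fg: "inj_on f {..<3}" "\<And>i. i < 3 \<Longrightarrow> f i < m"
      "\<And>j. j < 2 \<Longrightarrow> g j < length ws" "\<And>i j. i < 3 \<Longrightarrow> j < 2 \<Longrightarrow> A $$ (f i, g j) = M_matrix $$ (i, j)"
      by (rule contains_configurationE[OF conf, unfolded M A]) (rule that)
    have e: "ws ! g j ! f i = M_matrix $$ (i, j)" if "i < 3" "j < 2" for i j
      using fg(4)[OF that] entry[OF fg(2)[OF that(1)] fg(3)[OF that(2)]] by simp
    have Me: "M_matrix $$ (0, 0) = 0" "M_matrix $$ (1, 0) = 0" "M_matrix $$ (2, 0) = 1"
      "M_matrix $$ (0, 1) = 1" "M_matrix $$ (1, 1) = 1" "M_matrix $$ (2, 1) = 0"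
      by (simp_all add: M_matrix_def mat_of_rows_list_def)
    show False
    proof (rule no_M)
      show "ws ! g 0 \<in> C" "ws ! g 1 \<in> C" using fg(3)[of 0] fg(3)[of 1] ws(1) by auto
      show "f 0 < m" "f 1 < m" "f 2 < m" using fg(2) by simp_all
      show "f 0 \<noteq> f 1" "f 0 \<noteq> f 2" "f 1 \<noteq> f 2"
        using inj_onD[OF fg(1), of 0 1] inj_onD[OF fg(1), of 0 2] inj_onD[OF fg(1), of 1 2] by auto
    qed (use e[of 0 0] e[of 1 0] e[of 2 0] e[of 0 1] e[of 1 1] e[of 2 1] Me in simp_all)
  qed
  ultimately have "length ws \<in> {dim_col A | A. dim_row A = m \<and> r_matrix r A \<and> simple_matrix A \<and>
      \<not> contains_configuration A M_matrix}"
    using A by (intro CollectI exI[of _ A]) simp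
  then have "length ws \<le> forb m r M_matrix"
    unfolding forb_def by (rule Max_ge[OF finite_forb_set])
  then show ?thesis using distinct_card[OF ws(2)] ws(1) by simp
qed

lemma forb_M_ge_split_sum:
  assumes "3 \<le> r"
  shows "real (forb (leaves t) r M_matrix) \<ge>
    real (leaves t) * (real r - 1) ^ (leaves t - 1) + (real r - 1) ^ leaves t +
    (real r - 1) ^ leaves t / (real r - 2) ^ 2 * split_sum ((real r - 1) / (real r - 2)) t"
proof -
  let ?m = "leaves t"
  let ?C = "sorted_words r ?m \<union> inverted_words r t"
  have r: "2 \<le> r" using assms by simp
  have sub: "sorted_words r ?m \<subseteq> words {0..<r} ?m" by (auto simp: sorted_words_def)
  have fin: "finite (sorted_words r ?m)" "finite (inverted_words r t)"
    using finite_subset[OF sub finite_words] finite_subset[OF inverted_words_subset[OF r] finite_words]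
    by simp_all
  have "sorted_words r ?m \<inter> inverted_words r t = {}"
    using inverted_words_not_sorted by (auto simp: sorted_words_def)
  then have "card ?C = ?m * (r - 1) ^ (?m - 1) + (r - 1) ^ ?m + card (inverted_words r t)"
    using fin r by (simp add: card_Un_disjoint card_sorted_words)
  moreover have "card ?C \<le> forb ?m r M_matrix"
    using sub inverted_words_subset[OF r, of t] sorted_Un_inverted_no_M[OF r]
    by (intro forb_M_ge_card) (blast+)
  ultimately have "real (?m * (r - 1) ^ (?m - 1) + (r - 1) ^ ?m + card (inverted_words r t)) \<le> real (forb ?m r M_matrix)"
    by (simp only: of_nat_le_iff)
  then show ?thesis
    using assms by (simp add: card_inverted_words of_nat_diff)
qed

section \<open>The lower bounds\<close>

theorem theorem1p8:
  shows "(\<forall>\<alpha>::real. \<alpha> > 1 \<longrightarrow> (\<forall>\<epsilon>::real. \<epsilon> > 0 \<longrightarrow>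
            (\<forall>\<^sub>F m in sequentially.
               H2 m \<alpha> > 1 / 2 * (lambda_series \<alpha> - \<epsilon>) * real m * \<alpha> ^ m)))
       \<and>
         (\<forall>r::nat. r \<ge> 3 \<longrightarrow> (\<forall>\<epsilon>::real. \<epsilon> > 0 \<longrightarrow>
            (\<forall>\<^sub>F m in sequentially.
               real (forb m r M_matrix) \<ge>
                 (1 + (real r - 1) / (2 * (real r - 2) ^ 2)
                        * lambda_series ((real r - 1) / (real r - 2)) - \<epsilon>)
                   * real m * (real r - 1) ^ (m - 1)
                 + (real r - 1) ^ m)))"
proof (intro conjI allI impI)
  fix \<alpha> \<epsilon> :: real
  assume \<alpha>: "\<alpha> > 1" and \<epsilon>: "\<epsilon> > 0"
  show "\<forall>\<^sub>F m in sequentially. H2 m \<alpha> > 1 / 2 * (lambda_series \<alpha> - \<epsilon>) * real m * \<alpha> ^ m"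
    using eventually_exists_tree[OF \<alpha> \<epsilon>]
  proof eventually_elim
    case (elim m)
    then obtain t where t: "leaves t = m" "split_sum \<alpha> t > 1 / 2 * (lambda_series \<alpha> - \<epsilon>) * real m"
      by blast
    then have "1 / 2 * (lambda_series \<alpha> - \<epsilon>) * real m * \<alpha> ^ m < split_sum \<alpha> t * \<alpha> ^ m"
      using \<alpha> by (intro mult_strict_right_mono) auto
    also have "\<dots> \<le> H2 m \<alpha>" using H2_ge_split_sum[of \<alpha> t] \<alpha> t(1) by (simp add: mult.commute)
    finally show ?case .
  qed
next
  fix r :: nat and \<epsilon> :: real
  assume r: "r \<ge> 3" and \<epsilon>: "\<epsilon> > 0"
  define p q where "p = real r - 1" and "q = real r - 2"
  define \<delta> where "\<delta> = \<epsilon> * (2 * q ^ 2 / p)"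
  have pq: "p > 0" "q > 0" "p / q > 1" using r by (auto simp: p_def q_def)
  have "\<delta> > 0" using \<epsilon> pq by (simp add: \<delta>_def)
  have "\<forall>\<^sub>F m in sequentially. real (forb m r M_matrix) \<ge>
      (1 + p / (2 * q ^ 2) * lambda_series (p / q) - \<epsilon>) * real m * p ^ (m - 1) + p ^ m"
    using eventually_exists_tree[OF pq(3) \<open>\<delta> > 0\<close>] eventually_gt_at_top[of 0]
  proof eventually_elim
    case (elim m)
    then obtain t where t: "leaves t = m" "split_sum (p / q) t > 1 / 2 * (lambda_series (p / q) - \<delta>) * real m"
      by blast
    have pm: "p ^ m = p * p ^ (m - 1)" using elim(2) by (cases m) auto
    have "(p / (2 * q ^ 2) * lambda_series (p / q) - \<epsilon>) * real m * p ^ (m - 1) =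
        p ^ m / q ^ 2 * (1 / 2 * (lambda_series (p / q) - \<delta>) * real m)"
      using pq(1,2) unfolding pm by (simp add: \<delta>_def field_simps)
    also have "\<dots> \<le> p ^ m / q ^ 2 * split_sum (p / q) t"
      using t(2) pq by (intro mult_left_mono) auto
    finally have "(p / (2 * q ^ 2) * lambda_series (p / q) - \<epsilon>) * real m * p ^ (m - 1)
        \<le> p ^ m / q ^ 2 * split_sum (p / q) t" .
    moreover have "real m * p ^ (m - 1) + p ^ m + p ^ m / q ^ 2 * split_sum (p / q) t \<le> real (forb m r M_matrix)"
      using forb_M_ge_split_sum[OF r, of t] t(1) by (simp add: p_def q_def)
    ultimately show ?case by (simp add: algebra_simps)
  qed
  then show "\<forall>\<^sub>F m in sequentially. real (forb m r M_matrix) \<ge>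
      (1 + (real r - 1) / (2 * (real r - 2) ^ 2) * lambda_series ((real r - 1) / (real r - 2)) - \<epsilon>)
        * real m * (real r - 1) ^ (m - 1) + (real r - 1) ^ m"
    by (simp add: p_def q_def)
qed

end
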